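(* Let $H$ be any fixed graph with $v_H\ge 4$ and minimum degree $\delta_H\ge 2$. Then $$p_c(n,H)\ge \Omega\big(n^{-1/\lambda_*}(\log n)^{1/\lambda_*-1}\big),$$ i.e. there is a constant $c>0$ (depending only on $H$) such that $p_c(n,H)\ge c\,n^{-1/\lambda_*}(\log n)^{1/\lambda_*-1}$ for all sufficiently large $n$.
   Context: All graphs are finite and simple. $v_F$ and $e_F$ denote the numbers of vertices and edges of a graph $F$; $F\subset H$ means $F$ is a (not necessarily induced) subgraph of $H$. $H$-percolation: for graphs $G$ and $H$, set $G_0=G$ and, for $t\ge 1$, let $G_t$ (on the same vertex set as $G$) be obtained from $G_{t-1}$ by adding every edge not in $G_{t-1}$ which, if added to $G_{t-1}$, creates a new copy of $H$. Let $\langle G\rangle_H=\bigcup_t G_t$. $\mathcal G_{n,p}$ is the Erdős–Rényi random graph on $n$ labelled vertices, each edge of $K_n$ being present independently with probability $p$. The critical threshold is $$p_c(n,H)=\inf\{p>0:\ \mathbb P(\langle \mathcal G_{n,p}\rangle_H=K_n)\ge 1/2\}.$$ For a graph $H$ with $v_H\ge4$, $$\lambda_*=\min_{F}\frac{e_H-e_F-1}{v_H-v_F},$$ where the minimum is over all subgraphs $F\subset H$ with $2\le v_F<v_H$. (One has $\lambda_*>0$ if and only if $\delta_H\ge2$.) *)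

theory Defs
  imports "HOL-Probability.Probability"
begin

record 'a ugraph =
  vertices :: "'a set"
  edges :: "'a set set"

definition all_pairs :: "'a set \<Rightarrow> 'a set set" where
  "all_pairs V = {e. e \<subseteq> V \<and> card e = 2}"

definition fin_simple_graph :: "'a ugraph \<Rightarrow> bool" where
  "fin_simple_graph G \<longleftrightarrow> finite (vertices G) \<and> edges G \<subseteq> all_pairs (vertices G)"

abbreviation num_vertices :: "'a ugraph \<Rightarrow> nat" where
  "num_vertices G \<equiv> card (vertices G)"

abbreviation num_edges :: "'a ugraph \<Rightarrow> nat" where
  "num_edges G \<equiv> card (edges G)"

definition vertex_degree :: "'a ugraph \<Rightarrow> 'a \<Rightarrow> nat" where
  "vertex_degree G v = card {e \<in> edges G. v \<in> e}"

definition min_degree :: "'a ugraph \<Rightarrow> nat" where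
  "min_degree G = Min (vertex_degree G ` vertices G)"

definition complete_graph :: "'a set \<Rightarrow> 'a ugraph" where
  "complete_graph V = \<lparr>vertices = V, edges = all_pairs V\<rparr>"

text \<open>Subgraphs are not necessarily induced, and may be edgeless or have isolated vertices.\<close>

definition is_subgraph :: "'a ugraph \<Rightarrow> 'a ugraph \<Rightarrow> bool" where
  "is_subgraph F G \<longleftrightarrow>
     fin_simple_graph F \<and> vertices F \<subseteq> vertices G \<and> edges F \<subseteq> edges G"

definition graph_iso :: "'a ugraph \<Rightarrow> 'b ugraph \<Rightarrow> bool" where
  "graph_iso G G' \<longleftrightarrow>
     (\<exists>f. bij_betw f (vertices G) (vertices G') \<and> edges G' = (\<lambda>e. f ` e) ` edges G)"

definition copies :: "'a ugraph \<Rightarrow> 'b ugraph \<Rightarrow> 'b ugraph set" where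
  "copies H G = {K. is_subgraph K G \<and> graph_iso H K}"

definition add_edge :: "'a set \<Rightarrow> 'a ugraph \<Rightarrow> 'a ugraph" where
  "add_edge e G = \<lparr>vertices = vertices G, edges = insert e (edges G)\<rparr>"

definition creates_new_copy :: "'a ugraph \<Rightarrow> 'b ugraph \<Rightarrow> 'b set \<Rightarrow> bool" where
  "creates_new_copy H G e \<longleftrightarrow> copies H (add_edge e G) - copies H G \<noteq> {}"

definition percolation_step :: "'a ugraph \<Rightarrow> 'b ugraph \<Rightarrow> 'b ugraph" where
  "percolation_step H G =
     \<lparr>vertices = vertices G,
      edges = edges G \<union>
        {e \<in> all_pairs (vertices G). e \<notin> edges G \<and> creates_new_copy H G e}\<rparr>"

definition percolation_closure :: "'a ugraph \<Rightarrow> 'b ugraph \<Rightarrow> 'b ugraph" where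
  "percolation_closure H G =
     \<lparr>vertices = vertices G, edges = (\<Union>t. edges ((percolation_step H ^^ t) G))\<rparr>"

definition erdos_renyi :: "nat \<Rightarrow> real \<Rightarrow> nat ugraph pmf" where
  "erdos_renyi n p =
     map_pmf (\<lambda>X. \<lparr>vertices = {..<n}, edges = {e \<in> all_pairs {..<n}. X e}\<rparr>)
       (Pi_pmf (all_pairs {..<n}) False (\<lambda>_. bernoulli_pmf p))"

text \<open>The infimum is over a nonempty set (it contains \<open>p = 1\<close>); the bound \<open>p \<le> 1\<close> is explicit
  because \<^const>\<open>bernoulli_pmf\<close> is total and clamps its argument to the unit interval.\<close>

definition critical_threshold :: "nat \<Rightarrow> 'a ugraph \<Rightarrow> real" where
  "critical_threshold n H =
     Inf {p. 0 < p \<and> p \<le> 1 \<and>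
       measure_pmf.prob (erdos_renyi n p)
         {G. percolation_closure H G = complete_graph {..<n}} \<ge> 1 / 2}"

definition lambda_star :: "'a ugraph \<Rightarrow> real" where
  "lambda_star H =
     Min ((\<lambda>F. (real (num_edges H) - real (num_edges F) - 1) /
               (real (num_vertices H) - real (num_vertices F))) `
          {F. is_subgraph F H \<and> 2 \<le> num_vertices F \<and> num_vertices F < num_vertices H})"

end

theory Submission
  imports Defs "HOL-Real_Asymp.Real_Asymp"
begin

text \<open>
  Write \<open>\<mu>\<close> for \<open>lambda_star H\<close>, \<open>v\<^sub>H\<close> and \<open>e\<^sub>H\<close> for the numbers of vertices and edges of \<open>H\<close>.
  The idea is that an infected edge needs a witness: a vertex set with unusually many initial edges
  inside it, and that such sets are rare in the sparse random graph.

  Infect edges one by one, and group the infecting copies of \<open>H\<close> into clusters by merging whenever a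
  new copy shares an edge with an old cluster. By induction, a cluster on \<open>v\<close> vertices contains at
  least \<open>\<mu> * (v - v\<^sub>H) + e\<^sub>H - 1\<close> initial edges (\<open>tight_cluster_merge\<close>). A first copy has \<open>e\<^sub>H - 1\<close> of them.
  When a copy \<open>K\<close> merges clusters \<open>D\<close> with traces \<open>F\<^sub>D\<close> on \<open>K\<close>, the definition of \<open>\<mu>\<close> says
  \<open>e\<^sub>H - 1 - e(F\<^sub>D) \<ge> \<mu> * (v\<^sub>H - v(F\<^sub>D))\<close>, and so each \<open>D\<close> adds at least \<open>\<mu>\<close> initial edges for each vertex
  that it adds to \<open>K\<close>.

  A merger increases the largest cluster by a bounded factor at most. Hence, for any size \<open>L\<close>, either
  some cluster has a size between \<open>L\<close> and a constant multiple of \<open>L\<close>, or each pair that gets infected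
  lies in a cluster smaller than \<open>L\<close> (\<open>percolation_dense_on\<close>). Both alternatives imply the presence of
  \<open>v\<close> vertices spanning at least \<open>\<mu> * (v - 2) + 1\<close> initial edges, in the second one around a prescribed pair.

  The expected number of such sets is at most about \<open>(C * n * p powr \<mu> * v powr (\<mu> - 1)) ^ v\<close>. For
  \<open>p = c * n powr (- 1 / \<mu>) * (ln n) powr (1 / \<mu> - 1)\<close> the base equals
  \<open>C * c powr \<mu> * (v / ln n) powr (\<mu> - 1)\<close>. With \<open>L\<close> about \<open>ln n\<close> and \<open>c\<close> small, sets of size between \<open>L\<close> and
  a multiple of \<open>L\<close> are therefore unlikely to appear anywhere (\<open>large_sum_le\<close>). Small sets around one
  pair have two free vertices fewer, which leaves a factor \<open>p\<close> and makes them unlikely as well (\<open>small_sum_le\<close>).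
\<close>

section \<open>Subgraphs and copies\<close>

lemma finite_all_pairs: "finite V \<Longrightarrow> finite (all_pairs V)"
  by (rule finite_subset[of _ "Pow V"]) (auto simp: all_pairs_def)

lemma vertex_degree_ge_min_degree:
  assumes "finite (vertices G)" "v \<in> vertices G"
  shows "vertex_degree G v \<ge> min_degree G"
  unfolding min_degree_def using assms by auto

lemma Union_edges_eq_vertices:
  assumes "fin_simple_graph G" "min_degree G \<ge> 1"
  shows "\<Union>(edges G) = vertices G"
proof
  show "\<Union>(edges G) \<subseteq> vertices G"
    using assms(1) by (auto simp: fin_simple_graph_def all_pairs_def)
  show "vertices G \<subseteq> \<Union>(edges G)"
  proof
    fix v assume v: "v \<in> vertices G"
    have "card {e \<in> edges G. v \<in> e} \<noteq> 0"
      using vertex_degree_ge_min_degree[OF _ v] assms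
      by (auto simp: fin_simple_graph_def vertex_degree_def)
    then have "{e \<in> edges G. v \<in> e} \<noteq> {}" by (metis card.empty)
    then show "v \<in> \<Union>(edges G)" by auto
  qed
qed

lemma finite_edges: "fin_simple_graph G \<Longrightarrow> finite (edges G)"
  unfolding fin_simple_graph_def using finite_all_pairs finite_subset by blast

lemma finite_subgraphs:
  assumes "fin_simple_graph G"
  shows "finite {F. is_subgraph F G}"
proof (rule finite_subset)
  show "{F. is_subgraph F G} \<subseteq>
      (\<lambda>(V, E). \<lparr>vertices = V, edges = E\<rparr>) ` (Pow (vertices G) \<times> Pow (edges G))"
  proof
    fix F assume "F \<in> {F. is_subgraph F G}"
    then show "F \<in> (\<lambda>(V, E). \<lparr>vertices = V, edges = E\<rparr>) ` (Pow (vertices G) \<times> Pow (edges G))"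
      by (intro image_eqI[of _ _ "(vertices F, edges F)"]) (auto simp: is_subgraph_def)
  qed
  show "finite ((\<lambda>(V, E). \<lparr>vertices = V, edges = E\<rparr> :: 'a ugraph) ` (Pow (vertices G) \<times> Pow (edges G)))"
    using assms finite_edges[OF assms] by (auto simp: fin_simple_graph_def)
qed

lemma lambda_star_mult_le:
  assumes "fin_simple_graph H" "is_subgraph F H" "2 \<le> num_vertices F" "num_vertices F < num_vertices H"
  shows "lambda_star H * (real (num_vertices H) - real (num_vertices F))
           \<le> real (num_edges H) - real (num_edges F) - 1"
proof -
  have "lambda_star H \<le> (real (num_edges H) - real (num_edges F) - 1) /
               (real (num_vertices H) - real (num_vertices F))"
    unfolding lambda_star_def
    by (rule Min_le) (use assms finite_subgraphs[OF assms(1)] in auto)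
  then show ?thesis using assms(4) by (simp add: pos_le_divide_eq)
qed

text \<open>A vertex of \<open>H\<close> missed by \<open>F\<close> brings at least two edges that \<open>F\<close> cannot contain. This is
  where minimum degree two makes every ratio in the definition of \<open>lambda_star\<close> positive.\<close>

lemma edges_outside_proper_subgraph:
  assumes "fin_simple_graph H" "min_degree H \<ge> 2" "is_subgraph F H" "num_vertices F < num_vertices H"
  shows "num_edges F + 2 \<le> num_edges H"
proof -
  have finV: "finite (vertices H)" using assms(1) by (simp add: fin_simple_graph_def)
  obtain v where v: "v \<in> vertices H" "v \<notin> vertices F"
    using assms(3,4) by (metis is_subgraph_def nat_neq_iff subsetI subset_antisym)
  have d: "2 \<le> card {e \<in> edges H. v \<in> e}"
    using vertex_degree_ge_min_degree[OF finV v(1)] assms(2) by (simp add: vertex_degree_def)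
  have disj: "edges F \<inter> {e \<in> edges H. v \<in> e} = {}"
    using v assms(3) by (auto simp: is_subgraph_def fin_simple_graph_def all_pairs_def)
  have sub: "edges F \<union> {e \<in> edges H. v \<in> e} \<subseteq> edges H"
    using assms(3) by (auto simp: is_subgraph_def)
  note fin = finite_edges[OF assms(1)]
  have "num_edges F + card {e \<in> edges H. v \<in> e} = card (edges F \<union> {e \<in> edges H. v \<in> e})"
    using disj fin sub by (subst card_Un_disjoint) (auto intro: finite_subset)
  also have "\<dots> \<le> num_edges H" using sub fin by (rule card_mono[rotated])
  finally show ?thesis using d by simp
qed

lemma lambda_star_pos:
  assumes "fin_simple_graph H" "min_degree H \<ge> 2" "num_vertices H \<ge> 3"
  shows "lambda_star H > 0"
proof -
  let ?S = "{F. is_subgraph F H \<and> 2 \<le> num_vertices F \<and> num_vertices F < num_vertices H}"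
  have "finite ?S" by (rule finite_subset[OF _ finite_subgraphs[OF assms(1)]]) auto
  moreover have "?S \<noteq> {}"
  proof -
    obtain W where "W \<subseteq> vertices H" "card W = 2"
      by (rule obtain_subset_with_card_n[of 2 "vertices H"]) (use assms(3) in simp)
    then have "\<lparr>vertices = W, edges = {}\<rparr> \<in> ?S"
      using assms(1,3) by (auto simp: is_subgraph_def fin_simple_graph_def intro: finite_subset)
    then show ?thesis by blast
  qed
  moreover have "(real (num_edges H) - real (num_edges F) - 1) /
               (real (num_vertices H) - real (num_vertices F)) > 0" if "F \<in> ?S" for F
    using edges_outside_proper_subgraph[OF assms(1,2), of F] that
    by (intro divide_pos_pos) auto
  ultimately show ?thesis unfolding lambda_star_def by (subst Min_gr_iff) auto
qed

lemma graph_iso_cards: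
  assumes "fin_simple_graph H" "graph_iso H K"
  shows "num_vertices K = num_vertices H" "num_edges K = num_edges H"
proof -
  obtain f where f: "bij_betw f (vertices H) (vertices K)" "edges K = (\<lambda>e. f ` e) ` edges H"
    using assms(2) by (auto simp: graph_iso_def)
  show "num_vertices K = num_vertices H" using bij_betw_same_card[OF f(1)] by simp
  have "inj_on ((`) f) (Pow (vertices H))"
    using f(1) by (simp add: bij_betw_def inj_on_image_Pow)
  then have "inj_on ((`) f) (edges H)"
    by (rule inj_on_subset) (use assms(1) in \<open>auto simp: fin_simple_graph_def all_pairs_def\<close>)
  then show "num_edges K = num_edges H" by (simp add: f(2) card_image)
qed

lemma graph_iso_Union_edges:
  assumes "fin_simple_graph H" "min_degree H \<ge> 1" "graph_iso H K"
  shows "\<Union>(edges K) = vertices K"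
proof -
  obtain f where f: "bij_betw f (vertices H) (vertices K)" "edges K = (\<lambda>e. f ` e) ` edges H"
    using assms(3) by (auto simp: graph_iso_def)
  have "\<Union>(edges K) = f ` \<Union>(edges H)" unfolding f(2) by auto
  then show ?thesis using Union_edges_eq_vertices[OF assms(1,2)] f(1) by (simp add: bij_betw_def)
qed

text \<open>The form in which \<open>lambda_star\<close> is used: once a proper part \<open>F\<close> of a copy of \<open>H\<close> is present,
  completing the copy, up to the one edge that it creates, costs at least \<open>lambda_star H\<close> edges for
  each new vertex. The definition gives this for \<open>F\<close> with fewer vertices than \<open>H\<close>. If \<open>F\<close> spans
  the copy, the left side is zero and all that is needed is that \<open>F\<close> misses some edge, which will
  be the edge about to be created.\<close>

lemma lambda_star_mult_le_copy:
  assumes H: "fin_simple_graph H" and K: "graph_iso H K" and F: "is_subgraph F K"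
    and v2: "2 \<le> num_vertices F" and proper: "num_edges F < num_edges H"
  shows "lambda_star H * (real (num_vertices H) - real (num_vertices F))
           \<le> real (num_edges H) - real (num_edges F) - 1"
proof -
  obtain f where f: "bij_betw f (vertices H) (vertices K)" "edges K = (\<lambda>e. f ` e) ` edges H"
    using K by (auto simp: graph_iso_def)
  have finV: "finite (vertices H)" using H by (simp add: fin_simple_graph_def)
  then have finVK: "finite (vertices K)" using f(1) bij_betw_finite by blast
  have le: "num_vertices F \<le> num_vertices H"
    using card_mono[OF finVK, of "vertices F"] F graph_iso_cards[OF H K] by (simp add: is_subgraph_def)
  show ?thesis
  proof (cases "num_vertices F = num_vertices H")
    case True
    then show ?thesis using proper by simp
  next
    case False
    define F' where "F' = \<lparr>vertices = {x \<in> vertices H. f x \<in> vertices F}, edges = {e \<in> edges H. f ` e \<in> edges F}\<rparr>"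
    have inj: "inj_on f (vertices H)" and im: "f ` vertices H = vertices K"
      using f(1) by (auto simp: bij_betw_def)
    have Fsub: "\<And>e. e \<in> edges F \<Longrightarrow> e \<subseteq> vertices F"
      using F by (auto simp: is_subgraph_def fin_simple_graph_def all_pairs_def)
    have sub: "is_subgraph F' H"
      using H Fsub by (fastforce simp: is_subgraph_def F'_def fin_simple_graph_def all_pairs_def)
    have "f ` vertices F' = vertices F"
      using F im by (auto simp: F'_def is_subgraph_def)
    then have "bij_betw f (vertices F') (vertices F)"
      using inj by (auto simp: bij_betw_def F'_def inj_on_def)
    moreover have "edges F = (\<lambda>e. f ` e) ` edges F'"
      using F f(2) by (auto simp: F'_def is_subgraph_def)
    ultimately have iso: "graph_iso F' F" unfolding graph_iso_def by blast
    have fs: "fin_simple_graph F'" using sub by (simp add: is_subgraph_def)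
    show ?thesis
      using lambda_star_mult_le[OF H sub] graph_iso_cards[OF fs iso] v2 le False by simp
  qed
qed

section \<open>Clusters of infected edges\<close>

text \<open>A cluster \<open>D\<close> is a set of edges obtained by gluing copies of \<open>H\<close> along common edges, and \<open>E\<close> is
  the set of edges present initially; since \<open>H\<close> has no isolated vertex, \<open>\<Union>D\<close> is the vertex set of the
  cluster. The bound charges \<open>num_edges H - 1\<close> edges for a first copy and \<open>lambda_star H\<close> for
  each further vertex. It is normalised by a whole copy of \<open>H\<close> and not by a single edge, because this
  stronger normalisation passes through a merger of several clusters. With the bound
  \<open>lambda_star H * (v - 2) + 1\<close> the argument of the merging lemma loses a constant for every cluster
  beyond the first.\<close>

definition tight_cluster :: "'a ugraph \<Rightarrow> 'b set set \<Rightarrow> 'b set set \<Rightarrow> bool" where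
  "tight_cluster H E D \<longleftrightarrow> num_vertices H \<le> card (\<Union>D) \<and>
     lambda_star H * (real (card (\<Union>D)) - real (num_vertices H)) + real (num_edges H) - 1
       \<le> real (card (D \<inter> E))"

text \<open>Let \<open>K\<close> be the copy that infects \<open>e\<close>, and let \<open>\<D>\<close> be the clusters sharing an edge with it. For
  each \<open>D \<in> \<D>\<close> the trace of \<open>D\<close> on \<open>K\<close> is a subgraph with at least two vertices that misses \<open>e\<close>, so
  completing it to \<open>K\<close> costs at least \<open>lambda_star H\<close> edges per vertex. Subtracting this from the
  cluster bound for \<open>D\<close>, the constants belonging to \<open>H\<close> cancel: \<open>D\<close> brings, beyond its trace on \<open>K\<close>,
  at least \<open>lambda_star H\<close> initial edges for each of its vertices outside \<open>K\<close>. Adding the edges of \<open>K\<close>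
  itself gives the bound for the union. The second claim is the Aizenman--Lebowitz principle: at most
  \<open>num_edges H\<close> clusters are merged, so sizes grow by a bounded factor.\<close>

lemma tight_cluster_merge:
  fixes H :: "'a ugraph" and K :: "'b ugraph"
  assumes H: "fin_simple_graph H" "min_degree H \<ge> 2" "num_vertices H \<ge> 3"
    and K: "fin_simple_graph K" "graph_iso H K"
    and e: "e \<in> edges K" "e \<notin> \<Union>\<D>"
    and fin: "finite \<D>" "\<And>D. D \<in> \<D> \<Longrightarrow> finite D"
    and two: "\<And>D f. D \<in> \<D> \<Longrightarrow> f \<in> D \<Longrightarrow> card f = 2"
    and disj: "disjoint \<D>"
    and meet: "\<And>D. D \<in> \<D> \<Longrightarrow> D \<inter> edges K \<noteq> {}"
    and tight: "\<And>D. D \<in> \<D> \<Longrightarrow> tight_cluster H E D"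
    and KE: "edges K - {e} \<subseteq> E \<union> \<Union>\<D>"
  shows "tight_cluster H E (edges K \<union> \<Union>\<D>)"
    and "(\<And>D. D \<in> \<D> \<Longrightarrow> card (\<Union>D) \<le> l) \<Longrightarrow>
           card (\<Union>(edges K \<union> \<Union>\<D>)) \<le> num_vertices H + num_edges H * l"
proof -
  let ?lam = "lambda_star H"
  have lam: "?lam > 0" by (rule lambda_star_pos[OF H])
  have VK: "\<Union>(edges K) = vertices K" using graph_iso_Union_edges[OF H(1) _ K(2)] H(2) by simp
  have finVK: "finite (vertices K)" using K(1) by (simp add: fin_simple_graph_def)
  have finEK: "finite (edges K)" using finite_edges[OF K(1)] .
  note cards = graph_iso_cards[OF H(1) K(2)]
  have finU: "finite (\<Union>D)" if "D \<in> \<D>" for D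
  proof (rule finite_Union)
    show "finite D" using fin(2) that by simp
    fix f assume "f \<in> D"
    then have "card f = 2" using two that by simp
    then show "finite f" by (simp add: card_ge_0_finite)
  qed
  have un: "\<Union>(edges K \<union> \<Union>\<D>) = vertices K \<union> (\<Union>D\<in>\<D>. \<Union>D - vertices K)"
    using VK by auto
  have finun: "finite (vertices K \<union> (\<Union>D\<in>\<D>. \<Union>D - vertices K))"
    using finVK finU fin(1) by auto
  have size: "card (\<Union>(edges K \<union> \<Union>\<D>)) \<le> num_vertices H + (\<Sum>D\<in>\<D>. card (\<Union>D - vertices K))"
  proof -
    have "card (\<Union>(edges K \<union> \<Union>\<D>)) \<le> card (vertices K) + card (\<Union>D\<in>\<D>. \<Union>D - vertices K)"
      unfolding un by (rule card_Un_le)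
    also have "card (\<Union>D\<in>\<D>. \<Union>D - vertices K) \<le> (\<Sum>D\<in>\<D>. card (\<Union>D - vertices K))"
      by (rule card_UN_le[OF fin(1)])
    finally show ?thesis using cards by simp
  qed
  have EKcard: "card (edges K \<inter> \<Union>\<D>) = (\<Sum>D\<in>\<D>. card (D \<inter> edges K))"
  proof -
    have "edges K \<inter> \<Union>\<D> = (\<Union>D\<in>\<D>. D \<inter> edges K)" by auto
    moreover have "card (\<Union>D\<in>\<D>. D \<inter> edges K) = (\<Sum>D\<in>\<D>. card (D \<inter> edges K))"
      by (rule card_UN_disjoint) (use fin finEK disj in \<open>auto simp: disjoint_def\<close>)
    ultimately show ?thesis by simp
  qed
  have gain: "?lam * real (card (\<Union>D - vertices K)) \<le> real (card (D \<inter> E)) - real (card (D \<inter> edges K))"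
    if D: "D \<in> \<D>" for D
  proof -
    let ?F = "\<lparr>vertices = \<Union>D \<inter> vertices K, edges = D \<inter> edges K\<rparr>"
    have sub: "is_subgraph ?F K"
      using K(1) finVK by (auto simp: is_subgraph_def fin_simple_graph_def all_pairs_def)
    obtain f where f: "f \<in> D" "f \<in> edges K" using meet[OF D] by auto
    have "card f \<le> num_vertices ?F"
      by (rule card_mono) (use f VK finVK in auto)
    then have "2 \<le> num_vertices ?F" using two[OF D f(1)] by simp
    moreover have "D \<inter> edges K \<subset> edges K" using e D by auto
    then have "num_edges ?F < num_edges H" using psubset_card_mono[OF finEK] cards by simp
    ultimately have "?lam * (real (num_vertices H) - real (num_vertices ?F))
           \<le> real (num_edges H) - real (num_edges ?F) - 1"
      by (rule lambda_star_mult_le_copy[OF H(1) K(2) sub])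
    moreover have "card (\<Union>D - vertices K) + num_vertices ?F = card (\<Union>D)"
      using card_Diff_subset_Int[of "\<Union>D" "vertices K"] finU[OF D]
      by (simp add: card_mono)
    then have "real (card (\<Union>D)) = real (card (\<Union>D - vertices K)) + real (num_vertices ?F)"
      by linarith
    ultimately show ?thesis
      using tight[OF D] by (simp add: tight_cluster_def algebra_simps)
  qed
  \<comment> \<open>Initial edges of the union: those of the clusters, and the edges of K, other than e, that lie in no cluster.\<close>
  have "(\<Sum>D\<in>\<D>. card (D \<inter> E)) + card (edges K - {e} - \<Union>\<D>) =
      card ((\<Union>D\<in>\<D>. D \<inter> E) \<union> (edges K - {e} - \<Union>\<D>))"
  proof (subst card_Un_disjoint)
    show "finite (\<Union>D\<in>\<D>. D \<inter> E)" "finite (edges K - {e} - \<Union>\<D>)"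
      using fin finEK by auto
    show "(\<Union>D\<in>\<D>. D \<inter> E) \<inter> (edges K - {e} - \<Union>\<D>) = {}" by auto
    have "card (\<Union>D\<in>\<D>. D \<inter> E) = (\<Sum>D\<in>\<D>. card (D \<inter> E))"
      by (rule card_UN_disjoint) (use fin disj in \<open>auto simp: disjoint_def\<close>)
    then show "(\<Sum>D\<in>\<D>. card (D \<inter> E)) + card (edges K - {e} - \<Union>\<D>) =
       card (\<Union>D\<in>\<D>. D \<inter> E) + card (edges K - {e} - \<Union>\<D>)" by simp
  qed
  also have "\<dots> \<le> card ((edges K \<union> \<Union>\<D>) \<inter> E)"
    by (rule card_mono) (use KE fin finEK in auto)
  finally have c1: "(\<Sum>D\<in>\<D>. card (D \<inter> E)) + card (edges K - {e} - \<Union>\<D>)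
      \<le> card ((edges K \<union> \<Union>\<D>) \<inter> E)" .
  have c2: "card (edges K - {e} - \<Union>\<D>) + card (edges K \<inter> \<Union>\<D>) + 1 = num_edges H"
  proof -
    have "edges K = insert e ((edges K - {e} - \<Union>\<D>) \<union> (edges K \<inter> \<Union>\<D>))" using e by auto
    then have "num_edges K = card (insert e ((edges K - {e} - \<Union>\<D>) \<union> (edges K \<inter> \<Union>\<D>)))" by simp
    also have "\<dots> = Suc (card ((edges K - {e} - \<Union>\<D>) \<union> (edges K \<inter> \<Union>\<D>)))"
      by (rule card_insert_disjoint) (use finEK e in auto)
    also have "card ((edges K - {e} - \<Union>\<D>) \<union> (edges K \<inter> \<Union>\<D>)) =
        card (edges K - {e} - \<Union>\<D>) + card (edges K \<inter> \<Union>\<D>)"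
      by (rule card_Un_disjoint) (use finEK in auto)
    finally show ?thesis using cards by simp
  qed
  have "?lam * (\<Sum>D\<in>\<D>. real (card (\<Union>D - vertices K)))
      \<le> (\<Sum>D\<in>\<D>. real (card (D \<inter> E)) - real (card (D \<inter> edges K)))"
    unfolding sum_distrib_left by (rule sum_mono) (rule gain)
  also have "\<dots> = real (\<Sum>D\<in>\<D>. card (D \<inter> E)) - real (card (edges K \<inter> \<Union>\<D>))"
    unfolding EKcard by (simp add: sum_subtractf)
  also have "\<dots> \<le> real (card ((edges K \<union> \<Union>\<D>) \<inter> E)) - real (num_edges H) + 1"
    using c1 c2 by linarith
  finally have m: "?lam * (\<Sum>D\<in>\<D>. real (card (\<Union>D - vertices K)))
      \<le> real (card ((edges K \<union> \<Union>\<D>) \<inter> E)) - real (num_edges H) + 1" .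
  have "real (card (\<Union>(edges K \<union> \<Union>\<D>))) - real (num_vertices H) \<le> (\<Sum>D\<in>\<D>. real (card (\<Union>D - vertices K)))"
    using size by (simp flip: of_nat_sum of_nat_add)
  then have "?lam * (real (card (\<Union>(edges K \<union> \<Union>\<D>))) - real (num_vertices H))
      \<le> ?lam * (\<Sum>D\<in>\<D>. real (card (\<Union>D - vertices K)))"
    using lam by simp
  moreover have "num_vertices H \<le> card (\<Union>(edges K \<union> \<Union>\<D>))"
    using card_mono[OF finun, of "vertices K"] cards unfolding un by simp
  ultimately show "tight_cluster H E (edges K \<union> \<Union>\<D>)"
    using m unfolding tight_cluster_def by linarith
  assume l: "\<And>D. D \<in> \<D> \<Longrightarrow> card (\<Union>D) \<le> l"
  have "card \<D> \<le> (\<Sum>D\<in>\<D>. card (D \<inter> edges K))"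
  proof -
    have "(\<Sum>D\<in>\<D>. 1) \<le> (\<Sum>D\<in>\<D>. card (D \<inter> edges K))"
    proof (rule sum_mono)
      fix D assume "D \<in> \<D>"
      then show "1 \<le> card (D \<inter> edges K)"
        using meet finEK by (simp add: Suc_le_eq card_gt_0_iff)
    qed
    then show ?thesis by simp
  qed
  also have "\<dots> \<le> num_edges H" using EKcard c2 by simp
  finally have cD: "card \<D> \<le> num_edges H" .
  have "(\<Sum>D\<in>\<D>. card (\<Union>D - vertices K)) \<le> (\<Sum>D\<in>\<D>. l)"
  proof (rule sum_mono)
    fix D assume D: "D \<in> \<D>"
    show "card (\<Union>D - vertices K) \<le> l"
      using l[OF D] card_mono[OF finU[OF D], of "\<Union>D - vertices K"] by auto
  qed
  also have "\<dots> \<le> num_edges H * l" using cD by simp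
  finally show "card (\<Union>(edges K \<union> \<Union>\<D>)) \<le> num_vertices H + num_edges H * l"
    using size by linarith
qed

definition clustered :: "'a ugraph \<Rightarrow> nat \<Rightarrow> 'b set set \<Rightarrow> 'b set set \<Rightarrow> bool" where
  "clustered H L E I \<longleftrightarrow> (\<exists>\<C>. disjoint \<C> \<and> I = E \<union> \<Union>\<C> \<and>
     (\<forall>D\<in>\<C>. tight_cluster H E D \<and> card (\<Union>D) < L))"

text \<open>The witness that a cluster reached size \<open>L\<close>: the first time this happens, the size is at most the
  bound produced by one merger of clusters smaller than \<open>L\<close>.\<close>

definition intermediate_cluster :: "'a ugraph \<Rightarrow> nat \<Rightarrow> 'b set set \<Rightarrow> 'b set \<Rightarrow> bool" where
  "intermediate_cluster H L E V \<longleftrightarrow> (\<exists>D. D \<subseteq> all_pairs V \<and> tight_cluster H E D \<and> L \<le> card (\<Union>D) \<and>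
      card (\<Union>D) \<le> num_vertices H + num_edges H * L)"

text \<open>Edges are infected one at a time, each by one copy \<open>K\<close> of \<open>H\<close>. The clusters that meet \<open>K\<close> in an
  edge are replaced by their union with \<open>K\<close>; this keeps the clusters edge-disjoint.\<close>

lemma clustered_insert:
  fixes H :: "'a ugraph" and V :: "'b set"
  assumes H: "fin_simple_graph H" "min_degree H \<ge> 2" "num_vertices H \<ge> 3"
    and V: "finite V" and I: "I \<subseteq> all_pairs V" and cl: "clustered H L E I"
    and none: "\<not> intermediate_cluster H L E V"
    and e: "e \<notin> I" "e \<in> all_pairs V"
    and K: "fin_simple_graph K" "graph_iso H K" "edges K \<subseteq> insert e I" "e \<in> edges K"
  shows "clustered H L E (insert e I)"
proof -
  obtain \<C> where C: "disjoint \<C>" "I = E \<union> \<Union>\<C>" "\<And>D. D \<in> \<C> \<Longrightarrow> tight_cluster H E D"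
      "\<And>D. D \<in> \<C> \<Longrightarrow> card (\<Union>D) < L"
    using cl by (auto simp: clustered_def)
  have finI: "finite I" using I finite_all_pairs[OF V] finite_subset by blast
  have subI: "\<And>D. D \<in> \<C> \<Longrightarrow> D \<subseteq> I" using C(2) by auto
  have finC: "finite \<C>" by (rule finite_subset[of _ "Pow I"]) (use subI finI in auto)
  define \<D> where "\<D> = {D \<in> \<C>. D \<inter> edges K \<noteq> {}}"
  let ?D = "edges K \<union> \<Union>\<D>"
  have DC: "\<D> \<subseteq> \<C>" by (auto simp: \<D>_def)
  have eD: "e \<notin> \<Union>\<D>" using e(1) subI DC by auto
  have KE: "edges K - {e} \<subseteq> E \<union> \<Union>\<D>"
    using K(3) C(2) by (auto simp: \<D>_def)
  have merged: "tight_cluster H E ?D" "card (\<Union>?D) \<le> num_vertices H + num_edges H * L"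
  proof -
    have a: "finite \<D>" using finC DC by (rule finite_subset[rotated])
    have b: "\<And>D. D \<in> \<D> \<Longrightarrow> finite D" using subI DC finI by (meson finite_subset subsetD)
    have c: "\<And>D f. D \<in> \<D> \<Longrightarrow> f \<in> D \<Longrightarrow> card f = 2"
      using subI DC I by (auto simp: all_pairs_def subset_iff)
    have d: "disjoint \<D>" using C(1) DC by (rule pairwise_subset)
    show "tight_cluster H E ?D"
      by (rule tight_cluster_merge(1)[OF H K(1,2,4) eD a b c d _ _ KE])
         (use DC C(3) in \<open>auto simp: \<D>_def\<close>)
    show "card (\<Union>?D) \<le> num_vertices H + num_edges H * L"
      by (rule tight_cluster_merge(2)[OF H K(1,2,4) eD a b c d _ _ KE])
         (use DC C(3,4) in \<open>auto simp: \<D>_def intro: less_imp_le\<close>)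
  qed
  have sub: "?D \<subseteq> insert e I" using K(3) DC subI by blast
  then have "?D \<subseteq> all_pairs V" using I e(2) by blast
  then have lt: "card (\<Union>?D) < L" using none merged unfolding intermediate_cluster_def by (meson not_less)
  have "?D \<inter> D = {}" if D: "D \<in> \<C> - \<D>" for D
  proof -
    have "D' \<inter> D = {}" if "D' \<in> \<D>" for D'
      using disjointD[OF C(1), of D' D] D DC that by auto
    then show ?thesis using D by (auto simp: \<D>_def)
  qed
  moreover have "disjoint (\<C> - \<D>)" using C(1) by (rule pairwise_subset) auto
  ultimately have disj: "disjoint (insert ?D (\<C> - \<D>))"
    by (simp add: pairwise_insert disjnt_def Int_commute)
  have cover: "insert e I = E \<union> \<Union>(insert ?D (\<C> - \<D>))"
    using C(2) K(3,4) DC by auto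
  have "\<forall>D\<in>insert ?D (\<C> - \<D>). tight_cluster H E D \<and> card (\<Union>D) < L"
    using lt merged(1) C(3,4) by simp
  with disj cover show ?thesis unfolding clustered_def by (intro exI conjI)
qed

lemma creates_new_copyE:
  assumes "creates_new_copy H G e"
  obtains K where "fin_simple_graph K" "graph_iso H K" "edges K \<subseteq> insert e (edges G)" "e \<in> edges K"
proof -
  obtain K where K: "K \<in> copies H (add_edge e G)" "K \<notin> copies H G"
    using assms by (auto simp: creates_new_copy_def)
  then have "e \<in> edges K" by (auto simp: copies_def is_subgraph_def add_edge_def)
  with K that show ?thesis by (auto simp: copies_def is_subgraph_def add_edge_def)
qed

text \<open>All edges of one percolation step are infected by copies in the old graph, so adding them in an
  arbitrary order lets \<open>clustered_insert\<close> apply to each.\<close>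

lemma clustered_percolation_step:
  fixes H :: "'a ugraph" and G :: "'b ugraph"
  assumes H: "fin_simple_graph H" "min_degree H \<ge> 2" "num_vertices H \<ge> 3"
    and G: "fin_simple_graph G" and cl: "clustered H L E (edges G)"
    and none: "\<not> intermediate_cluster H L E (vertices G)"
  shows "clustered H L E (edges (percolation_step H G))"
proof -
  let ?V = "vertices G"
  let ?N = "{e \<in> all_pairs ?V. e \<notin> edges G \<and> creates_new_copy H G e}"
  have V: "finite ?V" using G by (simp add: fin_simple_graph_def)
  have GV: "edges G \<subseteq> all_pairs ?V" using G by (simp add: fin_simple_graph_def)
  have "clustered H L E (edges G \<union> A)" if "finite A" "A \<subseteq> ?N" for A
    using that
  proof (induction A)
    case empty
    then show ?case using cl by simp
  next
    case (insert e A)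
    then have e: "e \<in> all_pairs ?V" "e \<notin> edges G \<union> A" "creates_new_copy H G e" by auto
    obtain K where K: "fin_simple_graph K" "graph_iso H K" "edges K \<subseteq> insert e (edges G)" "e \<in> edges K"
      using creates_new_copyE[OF e(3)] by blast
    have "clustered H L E (insert e (edges G \<union> A))"
      by (rule clustered_insert[OF H V _ _ none e(2) e(1) K(1,2) _ K(4)])
         (use insert K(3) GV in auto)
    then show ?case by simp
  qed
  moreover have "finite ?N" using finite_all_pairs[OF V] by auto
  ultimately show ?thesis by (simp add: percolation_step_def)
qed

lemma percolation_iterate:
  assumes "fin_simple_graph G"
  shows "vertices ((percolation_step H ^^ t) G) = vertices G"
    and "fin_simple_graph ((percolation_step H ^^ t) G)"
proof -
  have *: "vertices ((percolation_step H ^^ t) G) = vertices G \<and>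
      fin_simple_graph ((percolation_step H ^^ t) G)"
    by (induction t) (use assms in \<open>auto simp: percolation_step_def fin_simple_graph_def\<close>)
  then show "vertices ((percolation_step H ^^ t) G) = vertices G"
    and "fin_simple_graph ((percolation_step H ^^ t) G)" by auto
qed

text \<open>What remains of a cluster once its history is forgotten: a property of the initial edges inside a
  vertex set alone. It holds for the two ends of an initial edge, with equality.\<close>

definition dense_on :: "real \<Rightarrow> 'b set set \<Rightarrow> 'b set \<Rightarrow> bool" where
  "dense_on \<mu> E U \<longleftrightarrow> \<mu> * (real (card U) - 2) + 1 \<le> real (card (all_pairs U \<inter> E))"

text \<open>Taking for \<open>F\<close> a single edge of \<open>H\<close> in the definition of \<open>lambda_star\<close> shows that the cluster bound
  is at least as strong as the bound normalised by one edge.\<close>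

lemma tight_cluster_dense_on:
  fixes H :: "'a ugraph" and V :: "'b set"
  assumes H: "fin_simple_graph H" "min_degree H \<ge> 2" "num_vertices H \<ge> 3"
    and D: "tight_cluster H E D" "D \<subseteq> all_pairs V" and V: "finite V"
  shows "dense_on (lambda_star H) E (\<Union>D)"
proof -
  have finVH: "finite (vertices H)" using H(1) by (simp add: fin_simple_graph_def)
  have "vertices H \<noteq> {}" using H(3) by auto
  then obtain e where e: "e \<in> edges H"
    using Union_edges_eq_vertices[OF H(1)] H(2) by fastforce
  have ce: "card e = 2" "e \<subseteq> vertices H" 
    using e H(1) by (auto simp: fin_simple_graph_def all_pairs_def)
  let ?F = "\<lparr>vertices = e, edges = {e}\<rparr>"
  have "is_subgraph ?F H"
    using ce e finite_subset[OF ce(2) finVH] by (auto simp: is_subgraph_def fin_simple_graph_def all_pairs_def)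
  from lambda_star_mult_le[OF H(1) this]
  have "lambda_star H * (real (num_vertices H) - 2) \<le> real (num_edges H) - 2"
    using ce H(3) by simp
  then have "lambda_star H * (real (card (\<Union>D)) - 2) + 1 \<le>
      lambda_star H * (real (card (\<Union>D)) - real (num_vertices H)) + real (num_edges H) - 1"
    by (simp add: algebra_simps)
  also have "\<dots> \<le> real (card (D \<inter> E))" using D by (simp add: tight_cluster_def)
  also have "card (D \<inter> E) \<le> card (all_pairs (\<Union>D) \<inter> E)"
  proof (rule card_mono)
    have "\<Union>D \<subseteq> V" using D(2) by (auto simp: all_pairs_def)
    then show "finite (all_pairs (\<Union>D) \<inter> E)" using finite_all_pairs V finite_subset by blast
    show "D \<inter> E \<subseteq> all_pairs (\<Union>D) \<inter> E" using D(2) by (auto simp: all_pairs_def)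
  qed
  finally show ?thesis by (simp add: dense_on_def)
qed

text \<open>If no cluster ever has an intermediate size, then all clusters stay below \<open>L\<close>, and the one that
  eventually contains \<open>e\<close> is a small dense set around \<open>e\<close>. The maximum with \<open>2\<close> accounts for an edge
  \<open>e\<close> that is present from the start.\<close>

lemma percolation_dense_on:
  fixes H :: "'a ugraph" and G :: "'b ugraph"
  assumes H: "fin_simple_graph H" "min_degree H \<ge> 2" "num_vertices H \<ge> 3"
    and G: "fin_simple_graph G" and e: "e \<in> all_pairs (vertices G)"
    and perc: "percolation_closure H G = complete_graph (vertices G)"
  shows "(\<exists>U \<subseteq> vertices G. L \<le> card U \<and> card U \<le> num_vertices H + num_edges H * L \<and>
             dense_on (lambda_star H) (edges G) U) \<or>
         (\<exists>U \<subseteq> vertices G. e \<subseteq> U \<and> card U \<le> max 2 L \<and>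
             dense_on (lambda_star H) (edges G) U)"
proof (cases "intermediate_cluster H L (edges G) (vertices G)")
  case True
  then obtain D where D: "D \<subseteq> all_pairs (vertices G)" "tight_cluster H (edges G) D" "L \<le> card (\<Union>D)"
      "card (\<Union>D) \<le> num_vertices H + num_edges H * L"
    by (auto simp: intermediate_cluster_def)
  have "finite (vertices G)" using G by (simp add: fin_simple_graph_def)
  note tight_cluster_dense_on[OF H D(2,1) this]
  moreover have "\<Union>D \<subseteq> vertices G" using D(1) by (auto simp: all_pairs_def)
  ultimately show ?thesis using D by blast
next
  case False
  have V: "finite (vertices G)" using G by (simp add: fin_simple_graph_def)
  have cl: "clustered H L (edges G) (edges ((percolation_step H ^^ t) G))" for t
  proof (induction t)
    case 0
    then show ?case unfolding clustered_def by (intro exI[of _ "{}"]) (auto simp: disjoint_def)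
  next
    case (Suc t)
    have "\<not> intermediate_cluster H L (edges G) (vertices ((percolation_step H ^^ t) G))"
      using False by (simp only: percolation_iterate(1)[OF G] not_False_eq_True)
    from clustered_percolation_step[OF H percolation_iterate(2)[OF G] Suc this]
    show ?case by simp
  qed
  have "e \<in> edges (percolation_closure H G)"
    using e unfolding perc by (simp add: complete_graph_def)
  then obtain t where t: "e \<in> edges ((percolation_step H ^^ t) G)"
    by (auto simp: percolation_closure_def)
  obtain \<C> where C: "edges ((percolation_step H ^^ t) G) = edges G \<union> \<Union>\<C>"
      "\<And>D. D \<in> \<C> \<Longrightarrow> tight_cluster H (edges G) D" "\<And>D. D \<in> \<C> \<Longrightarrow> card (\<Union>D) < L"
    using cl[of t] by (auto simp: clustered_def)
  have ce: "card e = 2" "e \<subseteq> vertices G" using e by (auto simp: all_pairs_def)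
  from t consider "e \<in> edges G" | D where "D \<in> \<C>" "e \<in> D" unfolding C(1) by auto
  then have "\<exists>U \<subseteq> vertices G. e \<subseteq> U \<and> card U \<le> max 2 L \<and> dense_on (lambda_star H) (edges G) U"
  proof cases
    case 1
    then have "{e} \<subseteq> all_pairs e \<inter> edges G" using ce by (auto simp: all_pairs_def)
    then have "card {e} \<le> card (all_pairs e \<inter> edges G)"
      by (rule card_mono[rotated]) (use finite_edges[OF G] in auto)
    then have "dense_on (lambda_star H) (edges G) e" using ce by (simp add: dense_on_def)
    then show ?thesis using ce by (intro exI[of _ e]) auto
  next
    case 2
    have sub: "D \<subseteq> all_pairs (vertices G)"
      using 2(1) C(1) percolation_iterate[OF G, where H = H and t = t] by (auto simp: fin_simple_graph_def)
    have "\<Union>D \<subseteq> vertices G" using sub by (auto simp: all_pairs_def)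
    then show ?thesis
      using tight_cluster_dense_on[OF H C(2)[OF 2(1)] sub V] C(3)[OF 2(1)] 2
      by (intro exI[of _ "\<Union>D"]) auto
  qed
  then show ?thesis ..
qed

section \<open>Dense vertex sets in the random graph\<close>

lemma power_div_fact_le_exp:
  fixes x :: real
  assumes "0 \<le> x"
  shows "x ^ m / fact m \<le> exp x"
proof -
  have "(\<Sum>k\<in>{m}. x ^ k /\<^sub>R fact k) \<le> (\<Sum>k. x ^ k /\<^sub>R fact k)"
    by (rule sum_le_suminf) (use assms summable_exp_generic[of x] in auto)
  then show ?thesis by (simp add: exp_def divide_inverse mult.commute)
qed

lemma binomial_le_exp:
  assumes "1 \<le> k" "1 \<le> n"
  shows "real (n choose k) \<le> exp (real k * (1 + ln (real n) - ln (real k)))"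
proof -
  have "real (n choose k) * fact k \<le> real n ^ k"
    using binomial_fact_pow[of n k] by (metis of_nat_fact of_nat_le_iff of_nat_mult of_nat_power)
  moreover have "real k ^ k \<le> exp (real k) * fact k"
    using power_div_fact_le_exp[of "real k" k] by (simp add: divide_le_eq)
  ultimately have "real (n choose k) * real k ^ k * fact k \<le> real n ^ k * exp (real k) * fact k"
    by (smt (verit, best) fact_ge_zero mult.assoc mult.commute mult_mono of_nat_0_le_iff zero_le_power)
  then have "real (n choose k) * real k ^ k \<le> real n ^ k * exp (real k)"
    by simp
  then have "real (n choose k) \<le> real n ^ k * exp (real k) / real k ^ k"
    using assms by (simp add: pos_le_divide_eq)
  also have "\<dots> = exp (real k * ln (real n)) * exp (real k) / exp (real k * ln (real k))"
    using assms by (simp add: exp_of_nat_mult)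
  also have "\<dots> = exp (real k * (1 + ln (real n) - ln (real k)))"
    by (simp add: exp_add[symmetric] exp_diff[symmetric] algebra_simps)
  finally show ?thesis .
qed

lemma prob_edges_present:
  assumes "0 \<le> p" "p \<le> 1" "S \<subseteq> all_pairs {..<n}"
  shows "measure_pmf.prob (erdos_renyi n p) {G. S \<subseteq> edges G} = p ^ card S"
proof -
  let ?A = "all_pairs {..<n::nat}"
  let ?B = "\<lambda>e. if e \<in> S then {True} else UNIV"
  have fin: "finite ?A" by (rule finite_all_pairs) simp
  have "(\<lambda>X. \<lparr>vertices = {..<n}, edges = {e \<in> ?A. X e}\<rparr>) -` {G. S \<subseteq> edges G} = Pi ?A ?B"
    using assms(3) by (auto simp: Pi_def split: if_splits)
  then have "measure_pmf.prob (erdos_renyi n p) {G. S \<subseteq> edges G} =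
      measure_pmf.prob (Pi_pmf ?A False (\<lambda>_. bernoulli_pmf p)) (Pi ?A ?B)"
    by (simp add: erdos_renyi_def)
  also have "\<dots> = (\<Prod>e\<in>?A. measure_pmf.prob (bernoulli_pmf p) (?B e))"
    by (rule measure_Pi_pmf_Pi[OF fin])
  also have "\<dots> = (\<Prod>e\<in>?A. if e \<in> S then p else 1)"
    by (rule prod.cong) (use assms(1,2) in \<open>auto simp: measure_pmf_single\<close>)
  also have "\<dots> = (\<Prod>e\<in>S. p)"
    using fin assms(3) by (simp add: prod.If_cases Int_absorb1)
  finally show ?thesis by simp
qed

lemma prob_UN_le:
  assumes "finite \<U>" "\<And>U. U \<in> \<U> \<Longrightarrow> measure_pmf.prob M (A U) \<le> b"
  shows "measure_pmf.prob M (\<Union>U\<in>\<U>. A U) \<le> real (card \<U>) * b"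
proof -
  have "measure_pmf.prob M (\<Union>U\<in>\<U>. A U) \<le> (\<Sum>U\<in>\<U>. measure_pmf.prob M (A U))"
    by (rule measure_pmf.finite_measure_subadditive_finite) (use assms(1) in auto)
  also have "\<dots> \<le> (\<Sum>U\<in>\<U>. b)" by (rule sum_mono) (rule assms(2))
  finally show ?thesis by simp
qed

lemma prob_many_edges_le:
  assumes p: "0 \<le> p" "p \<le> 1" and P: "P \<subseteq> all_pairs {..<n}"
  shows "measure_pmf.prob (erdos_renyi n p) {G. m \<le> card (P \<inter> edges G)}
    \<le> real (card P choose m) * p ^ m"
proof -
  let ?S = "{S. S \<subseteq> P \<and> card S = m}"
  have finP: "finite P" using finite_subset[OF P] finite_all_pairs by blast
  have fin: "finite ?S" by (rule finite_subset[of _ "Pow P"]) (use finP in auto)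
  have "{G. m \<le> card (P \<inter> edges G)} \<subseteq> (\<Union>S\<in>?S. {G. S \<subseteq> edges G})"
  proof
    fix G assume "G \<in> {G. m \<le> card (P \<inter> edges G)}"
    then have "m \<le> card (P \<inter> edges G)" by simp
    then obtain S where "S \<subseteq> P \<inter> edges G" "card S = m"
      by (rule obtain_subset_with_card_n)
    then show "G \<in> (\<Union>S\<in>?S. {G. S \<subseteq> edges G})" by auto
  qed
  then have "measure_pmf.prob (erdos_renyi n p) {G. m \<le> card (P \<inter> edges G)}
      \<le> measure_pmf.prob (erdos_renyi n p) (\<Union>S\<in>?S. {G. S \<subseteq> edges G})"
    by (intro measure_pmf.finite_measure_mono) auto
  also have "\<dots> \<le> real (card ?S) * p ^ m"
  proof (rule prob_UN_le[OF fin])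
    fix S assume "S \<in> ?S"
    then show "measure_pmf.prob (erdos_renyi n p) {G. S \<subseteq> edges G} \<le> p ^ m"
      using prob_edges_present[OF p, of S n] P by auto
  qed
  finally show ?thesis by (simp add: n_subsets[OF finP])
qed

text \<open>A set of \<open>v\<close> vertices spans at most \<open>v\<^sup>2\<close> pairs and has to contain some \<open>m \<ge> \<mu> * (v - 2) + 1\<close> edges.
  The choice of \<open>\<kappa>\<close> makes \<open>m \<ge> \<kappa> * v\<close>, so the expected number of such edge sets is at most
  \<open>(exp 1 * v\<^sup>2 * q / m) ^ m \<le> (exp 1 / \<kappa> * v * q) ^ m\<close>; as this base is at most one, the exponent may be
  lowered to the real number \<open>\<mu> * (v - 2) + 1\<close>. The bound is stated with an upper bound \<open>q\<close> of \<open>p\<close>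
  so that one estimate at \<open>q\<close> covers all smaller edge probabilities.\<close>

lemma prob_dense_on_le:
  assumes p: "0 < p" "p \<le> 1" "p \<le> q" and U: "U \<subseteq> {..<n}" "2 \<le> card U"
    and k: "0 < \<kappa>" "\<kappa> \<le> \<mu>" "\<kappa> \<le> 1 / 2"
    and small: "exp 1 / \<kappa> * real (card U) * q \<le> 1"
  shows "measure_pmf.prob (erdos_renyi n p) {G. dense_on \<mu> (edges G) U}
     \<le> exp ((\<mu> * (real (card U) - 2) + 1) * ln (exp 1 / \<kappa> * real (card U) * q))"
proof -
  define v where "v = card U"
  define r where "r = \<mu> * (real v - 2) + 1"
  define m where "m = nat \<lceil>r\<rceil>"
  define x where "x = exp 1 / \<kappa> * real v * q"
  have v: "2 \<le> v" using U by (simp add: v_def)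
  have q: "0 < q" using p by simp
  have x: "0 < x" "x \<le> 1" using small k q v by (auto simp: x_def v_def)
  have "\<kappa> * (real v - 2) + 2 * \<kappa> \<le> r"
    unfolding r_def using k v by (intro add_mono mult_right_mono) auto
  then have "\<kappa> * real v \<le> r" by (simp add: algebra_simps)
  then have mr: "r \<le> real m" and m: "\<kappa> * real v \<le> real m"
    unfolding m_def by linarith+
  have m0: "0 < real m" using m k v by (smt (verit) mult_pos_pos of_nat_0_less_iff pos2 order_less_le_trans)
  have finU: "finite U" using U(1) finite_subset by blast
  have cP: "card (all_pairs U) \<le> v ^ 2"
  proof -
    have "card (all_pairs U) = v choose 2"
      unfolding all_pairs_def v_def using n_subsets[OF finU] by simp
    also have "\<dots> \<le> v ^ 2" using v by (rule binomial_le_pow)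
    finally show ?thesis .
  qed
  have eq: "{G. dense_on \<mu> (edges G) U} = {G. m \<le> card (all_pairs U \<inter> edges G)}"
    unfolding dense_on_def v_def[symmetric] r_def[symmetric] m_def by (simp add: nat_le_iff ceiling_le_iff)
  have "measure_pmf.prob (erdos_renyi n p) {G. m \<le> card (all_pairs U \<inter> edges G)}
      \<le> real (card (all_pairs U) choose m) * p ^ m"
    using p U by (intro prob_many_edges_le) (auto simp: all_pairs_def)
  also have "\<dots> \<le> (real (v ^ 2) ^ m / fact m) * q ^ m"
  proof (rule mult_mono)
    have "real (card (all_pairs U) choose m) * fact m \<le> real (card (all_pairs U)) ^ m"
      using binomial_fact_pow[of "card (all_pairs U)" m]
      by (metis of_nat_fact of_nat_le_iff of_nat_mult of_nat_power)
    also have "\<dots> \<le> real (v ^ 2) ^ m"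
      using cP by (intro power_mono) auto
    finally show "real (card (all_pairs U) choose m) \<le> real (v ^ 2) ^ m / fact m"
      by (simp add: pos_le_divide_eq)
    show "p ^ m \<le> q ^ m" using p by (intro power_mono) auto
  qed (use p in auto)
  also have "\<dots> \<le> (exp (real m) / real m ^ m) * real (v ^ 2) ^ m * q ^ m"
  proof -
    have "1 / fact m \<le> exp (real m) / real m ^ m"
      using power_div_fact_le_exp[of "real m" m] m0 by (simp add: field_simps)
    then have "1 / fact m * (real (v ^ 2) ^ m * q ^ m) \<le> exp (real m) / real m ^ m * (real (v ^ 2) ^ m * q ^ m)"
      using q by (intro mult_right_mono) auto
    then show ?thesis by (simp add: mult.assoc)
  qed
  also have "\<dots> = (exp 1 * real v ^ 2 * q / real m) ^ m"
    by (simp add: power_mult_distrib power_divide exp_of_nat_mult[symmetric])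
  also have "\<dots> \<le> x ^ m"
  proof (rule power_mono)
    have "exp 1 * real v ^ 2 * q / real m \<le> exp 1 * real v ^ 2 * q / (\<kappa> * real v)"
      using m m0 k v q by (intro divide_left_mono) auto
    also have "\<dots> = x" using v by (simp add: x_def power2_eq_square)
    finally show "exp 1 * real v ^ 2 * q / real m \<le> x" .
  qed (use q in auto)
  also have "\<dots> = exp (real m * ln x)" using x by (simp add: exp_of_nat_mult)
  also have "\<dots> \<le> exp (r * ln x)" using x mr by (simp add: mult_right_mono_neg)
  finally show ?thesis unfolding eq[symmetric] r_def x_def v_def .
qed

text \<open>The union bound over dense sets, graded by size. The family \<open>\<F> v\<close> will be either all \<open>v\<close>-sets, or
  those containing a fixed pair of vertices.\<close>

lemma prob_ex_dense_on_le:
  fixes \<F> :: "nat \<Rightarrow> nat set set"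
  assumes p: "0 < p" "p \<le> 1" "p \<le> q" 
    and k: "0 < \<kappa>" "\<kappa> \<le> \<mu>" "\<kappa> \<le> 1 / 2"
    and small: "exp 1 / \<kappa> * real b * q \<le> 1"
    and F: "\<And>v U. v \<in> {a..b} \<Longrightarrow> U \<in> \<F> v \<Longrightarrow> U \<subseteq> {..<n} \<and> card U = v"
    and N: "\<And>v. v \<in> {a..b} \<Longrightarrow> real (card (\<F> v)) \<le> N v" and a: "2 \<le> a"
  shows "measure_pmf.prob (erdos_renyi n p) {G. \<exists>v\<in>{a..b}. \<exists>U\<in>\<F> v. dense_on \<mu> (edges G) U}
     \<le> (\<Sum>v\<in>{a..b}. N v * exp ((\<mu> * (real v - 2) + 1) * ln (exp 1 / \<kappa> * real v * q)))"
proof -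
  let ?P = "measure_pmf.prob (erdos_renyi n p)"
  let ?A = "\<lambda>v. \<Union>U\<in>\<F> v. {G. dense_on \<mu> (edges G) U}"
  have "{G. \<exists>v\<in>{a..b}. \<exists>U\<in>\<F> v. dense_on \<mu> (edges G) U} = (\<Union>v\<in>{a..b}. ?A v)" by auto
  then have "?P {G. \<exists>v\<in>{a..b}. \<exists>U\<in>\<F> v. dense_on \<mu> (edges G) U} = ?P (\<Union>v\<in>{a..b}. ?A v)"
    by (rule arg_cong)
  also have "\<dots> \<le> (\<Sum>v\<in>{a..b}. ?P (?A v))"
    by (rule measure_pmf.finite_measure_subadditive_finite) auto
  also have "\<dots> \<le> (\<Sum>v\<in>{a..b}. N v * exp ((\<mu> * (real v - 2) + 1) * ln (exp 1 / \<kappa> * real v * q)))"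
  proof (rule sum_mono)
    fix v assume v: "v \<in> {a..b}"
    have "finite (\<F> v)" by (rule finite_subset[of _ "Pow {..<n}"]) (use F[OF v] in auto)
    then have "?P (?A v) \<le> real (card (\<F> v)) * exp ((\<mu> * (real v - 2) + 1) * ln (exp 1 / \<kappa> * real v * q))"
    proof (rule prob_UN_le)
      fix U assume U: "U \<in> \<F> v"
      have "exp 1 / \<kappa> * real v * q \<le> exp 1 / \<kappa> * real b * q"
        using v k p by (intro mult_right_mono mult_left_mono) auto
      then have "exp 1 / \<kappa> * real (card U) * q \<le> 1" using small F[OF v U] by simp
      then show "?P {G. dense_on \<mu> (edges G) U} \<le> exp ((\<mu> * (real v - 2) + 1) * ln (exp 1 / \<kappa> * real v * q))"
        using prob_dense_on_le[OF p, of U n \<kappa> \<mu>] F[OF v U] k v a by auto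
    qed
    also have "\<dots> \<le> N v * exp ((\<mu> * (real v - 2) + 1) * ln (exp 1 / \<kappa> * real v * q))"
      by (intro mult_right_mono N[OF v]) simp
    finally show "?P (?A v) \<le> N v * exp ((\<mu> * (real v - 2) + 1) * ln (exp 1 / \<kappa> * real v * q))" .
  qed
  finally show ?thesis .
qed

lemma card_supersets_of_pair_le:
  assumes "e \<subseteq> {..<n::nat}" "card e = 2" 
  shows "card {U. e \<subseteq> U \<and> U \<subseteq> {..<n} \<and> card U = v} \<le> n choose (v - 2)"
proof -
  let ?S = "{U. e \<subseteq> U \<and> U \<subseteq> {..<n} \<and> card U = v}"
  have "card ?S \<le> card {W. W \<subseteq> {..<n} \<and> card W = v - 2}"
  proof (rule card_inj_on_le[where f = "\<lambda>U. U - e"])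
    show "inj_on (\<lambda>U. U - e) ?S" by (auto simp: inj_on_def)
    show "(\<lambda>U. U - e) ` ?S \<subseteq> {W. W \<subseteq> {..<n} \<and> card W = v - 2}"
    proof
      fix W assume "W \<in> (\<lambda>U. U - e) ` ?S"
      then obtain U where U: "W = U - e" "e \<subseteq> U" "U \<subseteq> {..<n}" "card U = v" by blast
      have "finite e" using assms(1) finite_subset by blast
      then show "W \<in> {W. W \<subseteq> {..<n} \<and> card W = v - 2}"
        using U assms(2) card_Diff_subset[of e U] by auto
    qed
    show "finite {W. W \<subseteq> {..<n} \<and> card W = v - 2}"
      by (rule finite_subset[of _ "Pow {..<n}"]) auto
  qed
  also have "\<dots> = n choose (v - 2)" using n_subsets[of "{..<n}" "v - 2"] by simp
  finally show ?thesis .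
qed

section \<open>Estimating the union bounds\<close>

text \<open>With \<open>l = ln n\<close> and \<open>q = c * n powr (- 1 / \<mu>) * l powr (1 / \<mu> - 1)\<close>, the quantity \<open>X\<close> is the logarithm
  of \<open>(exp 1 * n / w) ^ w * (b * w * q) powr (\<mu> * w)\<close>, which is the part
  exponential in \<open>w\<close> of the bound on the expected number of dense sets of size \<open>w\<close>. The powers of \<open>n\<close> cancel and leave
  \<open>X = w * (1 + \<mu> * ln (b * c) + (\<mu> - 1) * ln (w / l))\<close>. The logarithmic factor in \<open>q\<close> is exactly what makes
  \<open>w\<close> enter only through \<open>w / l\<close>, which is between \<open>1\<close> and \<open>D\<close> for sizes from \<open>l\<close> to \<open>D * l\<close>; there a small \<open>c\<close>
  makes \<open>X\<close> very negative. For \<open>\<mu> < 1\<close> and smaller \<open>w\<close> the last term is positive, but at most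
  \<open>(1 - \<mu>) * l\<close>, because \<open>w * ln (l / w) \<le> l\<close>.\<close>

lemma ln_union_bound_term_le:
  fixes w c b D l \<mu> :: real
  assumes w: "1 \<le> w" "w \<le> D * l" and D: "1 \<le> D" and l: "1 \<le> l" and lam: "0 < \<mu>"
    and b: "0 < b" and c: "0 < c" "1 + \<mu> * ln (b * c * D) \<le> -3"
    and q: "ln q = ln c - l / \<mu> + (1 / \<mu> - 1) * ln l" "0 < q"
  defines "X \<equiv> w * (1 + l - ln w) + \<mu> * w * ln (b * w * q)"
  shows "l \<le> w \<Longrightarrow> X \<le> -3 * l" and "X \<le> max 0 (1 - \<mu>) * l"
proof -
  define t where "t = ln w - ln l"
  have pos: "0 < w" "0 < l" "0 < D" using w l D by auto
  have e1: "ln (b * w * q) = ln b + ln w + ln q" using b pos q(2) by (simp add: ln_mult)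
  have e2: "\<mu> * ln (b * w * q) = \<mu> * ln b + \<mu> * ln w + \<mu> * ln c - l + (1 - \<mu>) * ln l"
    unfolding e1 q(1) using lam by (simp add: field_simps)
  have X: "X = w * (1 + \<mu> * ln b + \<mu> * ln c + (\<mu> - 1) * t)"
  proof -
    have "X = w * (1 + l - ln w + \<mu> * ln (b * w * q))" by (simp add: X_def algebra_simps)
    also have "\<dots> = w * (1 + \<mu> * ln b + \<mu> * ln c + (\<mu> - 1) * t)"
      unfolding e2 t_def by (simp add: algebra_simps)
    finally show ?thesis .
  qed
  have c': "1 + \<mu> * ln b + \<mu> * ln c \<le> -3 - \<mu> * ln D"
    using c b pos by (simp add: ln_mult algebra_simps)
  have lnD: "0 \<le> ln D" using D by simp
  have "ln w \<le> ln (D * l)" using w pos by simp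
  then have tD: "t \<le> ln D" using pos by (simp add: t_def ln_mult)
  have Xle: "X \<le> w * (-3 - \<mu> * ln D + (\<mu> - 1) * t)"
    unfolding X using c' pos by (intro mult_left_mono) auto
  have cases: "(\<mu> - 1) * t \<le> \<mu> * ln D" if "\<mu> \<ge> 1 \<or> t \<ge> 0"
  proof (cases "\<mu> \<ge> 1")
    case True
    then have "(\<mu> - 1) * t \<le> (\<mu> - 1) * ln D" using tD by (intro mult_left_mono) auto
    then show ?thesis using lnD by (simp add: algebra_simps)
  next
    case False
    then have "(\<mu> - 1) * t \<le> 0" using that by (simp add: mult_nonpos_nonneg)
    also have "0 \<le> \<mu> * ln D" using lam lnD by simp
    finally show ?thesis .
  qed
  have good: "X \<le> -3 * w" if "\<mu> \<ge> 1 \<or> t \<ge> 0"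
  proof -
    have "X \<le> w * (-3)" using cases[OF that] pos by (intro order_trans[OF Xle] mult_left_mono) auto
    then show ?thesis by simp
  qed
  {
    assume "l \<le> w"
    then have "0 \<le> t" using pos by (simp add: t_def)
    then show "X \<le> -3 * l" using good \<open>l \<le> w\<close> by linarith
  }
  show "X \<le> max 0 (1 - \<mu>) * l"
  proof (cases "\<mu> \<ge> 1")
    case True
    then show ?thesis using good pos by auto
  next
    case False
    have "ln (l / w) \<le> l / w - 1" using pos by (intro ln_le_minus_one) auto
    then have "- t \<le> l / w" using pos by (simp add: t_def ln_div)
    then have "w * (- t) \<le> w * (l / w)" using pos by (intro mult_left_mono) auto
    then have "w * (- t) \<le> l" using pos by simp
    then have *: "(1 - \<mu>) * (w * (- t)) \<le> (1 - \<mu>) * l" using False by (intro mult_left_mono) auto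
    have "0 \<le> \<mu> * ln D" using lam lnD by simp
    then have "X \<le> w * ((\<mu> - 1) * t)"
      using pos by (intro order_trans[OF Xle] mult_left_mono) auto
    also have "\<dots> = (1 - \<mu>) * (w * (- t))" by (simp add: algebra_simps)
    also note *
    finally show ?thesis using False by simp
  qed
qed

lemma powr_exp_neg_tendsto_0:
  fixes a b :: real
  assumes "0 < b"
  shows "((\<lambda>l. l powr a * exp (- b * l)) \<longlongrightarrow> 0) at_top"
  using assms by real_asymp

text \<open>Upper bounds for the two union bounds, each as a number of sizes (at most \<open>D * l\<close>) times a uniform
  bound on one term: \<open>large_bound\<close> for sets of intermediate size anywhere, and \<open>small_bound\<close> for small
  sets around a fixed pair.\<close>

definition large_bound :: "real \<Rightarrow> real \<Rightarrow> real \<Rightarrow> real \<Rightarrow> real" where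
  "large_bound \<mu> D l q = D * l * exp (- 3 * l - 2 * \<mu> * ln q)"

definition small_bound :: "real \<Rightarrow> real \<Rightarrow> real \<Rightarrow> real \<Rightarrow> real \<Rightarrow> real" where
  "small_bound \<mu> C D l q = D * l * (exp (max 0 (1 - \<mu>) * l) * (C * (D * l) * q))"

text \<open>The exponent \<open>\<mu> * (v - 2) + 1\<close> differs from \<open>\<mu> * v\<close> by a constant, which costs at most a factor
  \<open>q powr (- 2 * \<mu>)\<close>, about \<open>n\<^sup>2\<close>. The gain \<open>exp (- 3 * l)\<close>, that is \<open>n\<close> to the power \<open>- 3\<close>, absorbs it.\<close>

lemma large_sum_le:
  fixes \<mu> C D l q c :: real
  assumes lam: "0 < \<mu>" and C: "1 \<le> C" and D: "1 \<le> D" and c: "0 < c" "1 + \<mu> * ln (3 * C * c * D) \<le> -3"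
    and l: "1 \<le> l" "l = ln (real n)" and q: "ln q = ln c - l / \<mu> + (1 / \<mu> - 1) * ln l" "0 < q"
    and small: "C * (D * l) * q \<le> 1"
    and L: "l \<le> real L" and M: "real M \<le> D * l"
  shows "(\<Sum>v\<in>{L..M}. real (n choose v) * exp ((\<mu> * (real v - 2) + 1) * ln (C * real v * q))) \<le> large_bound \<mu> D l q"
proof -
  have n: "1 \<le> n" using l by (cases n) auto
  have summand: "real (n choose v) * exp ((\<mu> * (real v - 2) + 1) * ln (C * real v * q)) \<le> exp (- 3 * l - 2 * \<mu> * ln q)"
    if v: "v \<in> {L..M}" for v
  proof -
    have v1: "1 \<le> v" "l \<le> real v" "1 \<le> real v" "real v \<le> D * l" using v L M l by auto
    define y where "y = ln (C * real v * q)"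
    have "C * real v * q \<le> C * (D * l) * q"
      using v1 C q by (intro mult_right_mono mult_left_mono) auto
    then have "C * real v * q \<le> 1" using small by simp
    then have y0: "y \<le> 0" using C v1 q by (simp add: y_def)
    have "1 * q \<le> C * real v * q"
      using C v1 q mult_mono[of 1 C 1 "real v"] by (intro mult_right_mono) auto
    then have yq: "ln q \<le> y" unfolding y_def using q(2) by (intro iffD2[OF ln_le_cancel_iff]) auto
    have y3: "y \<le> ln (3 * C * real v * q)" unfolding y_def using C v1 q by simp
    have c': "1 + \<mu> * ln ((3 * C) * c * D) \<le> - 3" using c by simp
    have X: "real v * (1 + l - ln (real v)) + \<mu> * real v * ln (3 * C * real v * q) \<le> -3 * l"
      by (rule ln_union_bound_term_le(1)[OF v1(3,4) D l(1) lam _ c(1) c' q v1(2)]) (use C in simp)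
    have "real (n choose v) * exp ((\<mu> * (real v - 2) + 1) * y)
       \<le> exp (real v * (1 + l - ln (real v))) * exp ((\<mu> * (real v - 2) + 1) * y)"
      using binomial_le_exp[OF v1(1) n] l(2) by (intro mult_right_mono) auto
    also have "\<dots> = exp (real v * (1 + l - ln (real v)) + \<mu> * real v * y + (1 - 2 * \<mu>) * y)"
      by (simp add: exp_add[symmetric] algebra_simps)
    also have "\<dots> \<le> exp (- 3 * l - 2 * \<mu> * ln q)"
    proof -
      have "\<mu> * real v * y \<le> \<mu> * real v * ln (3 * C * real v * q)"
        using y3 lam by (intro mult_left_mono) auto
      moreover have "2 * \<mu> * ln q \<le> 2 * \<mu> * y" using yq lam by simp
      ultimately have "real v * (1 + l - ln (real v)) + \<mu> * real v * y + (1 - 2 * \<mu>) * y \<le> - 3 * l - 2 * \<mu> * ln q"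
        using X y0 by (simp add: algebra_simps)
      then show ?thesis by simp
    qed
    finally show ?thesis unfolding y_def .
  qed
  have "(\<Sum>v\<in>{L..M}. real (n choose v) * exp ((\<mu> * (real v - 2) + 1) * ln (C * real v * q)))
      \<le> real (card {L..M}) * exp (- 3 * l - 2 * \<mu> * ln q)"
    by (rule sum_bounded_above) (rule summand)
  also have "\<dots> \<le> D * l * exp (- 3 * l - 2 * \<mu> * ln q)"
  proof (rule mult_right_mono)
    have "1 \<le> L" using L l by (cases L) auto
    then have "card {L..M} \<le> M" by simp
    then show "real (card {L..M}) \<le> D * l" using M by linarith
  qed simp
  finally show ?thesis by (simp add: large_bound_def)
qed

text \<open>Only \<open>w = v - 2\<close> vertices are free, and the exponent is \<open>\<mu> * w + 1\<close>: the extra \<open>1\<close> leaves a factor of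
  order \<open>q\<close> times a logarithm, which decays faster than the other factor, at most
  \<open>n powr max 0 (1 - \<mu>)\<close>, can grow. Replacing \<open>v\<close> by \<open>3 * w\<close> in the base is why the smallness of \<open>c\<close>
  is required with \<open>3 * C\<close>.\<close>

lemma small_sum_le:
  fixes \<mu> C D l q c :: real
  assumes lam: "0 < \<mu>" and C: "1 \<le> C" and D: "1 \<le> D" and c: "0 < c" "1 + \<mu> * ln (3 * C * c * D) \<le> -3"
    and l: "1 \<le> l" "l = ln (real n)" and q: "ln q = ln c - l / \<mu> + (1 / \<mu> - 1) * ln l" "0 < q"
    and M: "real M \<le> D * l"
  shows "(\<Sum>v\<in>{2..M}. real (n choose (v - 2)) * exp ((\<mu> * (real v - 2) + 1) * ln (C * real v * q))) \<le> small_bound \<mu> C D l q"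
proof -
  have n: "1 \<le> n" using l by (cases n) auto
  have summand: "real (n choose (v - 2)) * exp ((\<mu> * (real v - 2) + 1) * ln (C * real v * q))
      \<le> exp (max 0 (1 - \<mu>) * l) * (C * (D * l) * q)"
    if v: "v \<in> {2..M}" for v
  proof -
    have pos: "0 < C * real v * q" using C v q by simp
    have vD: "C * real v * q \<le> C * (D * l) * q"
      using v M C q by (intro mult_right_mono mult_left_mono) auto
    have split: "exp ((\<mu> * (real v - 2) + 1) * ln (C * real v * q)) =
        exp (\<mu> * (real v - 2) * ln (C * real v * q)) * (C * real v * q)"
      using pos by (simp add: exp_add distrib_right)
    have main: "real (n choose (v - 2)) * exp (\<mu> * (real v - 2) * ln (C * real v * q)) \<le> exp (max 0 (1 - \<mu>) * l)"
    proof (cases "v = 2")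
      case True
      then show ?thesis using l(1) by simp
    next
      case False
      define w where "w = v - 2"
      have w: "1 \<le> w" "1 \<le> real w" "real v - 2 = real w" "real w \<le> D * l" "real v \<le> 3 * real w"
        using False v M by (auto simp: w_def)
      have c': "1 + \<mu> * ln ((3 * C) * c * D) \<le> - 3" using c by simp
      have X: "real w * (1 + l - ln (real w)) + \<mu> * real w * ln (3 * C * real w * q) \<le> max 0 (1 - \<mu>) * l"
        by (rule ln_union_bound_term_le(2)[OF w(2,4) D l(1) lam _ c(1) c' q]) (use C in simp)
      have "C * real v * q \<le> 3 * C * real w * q"
        using w(5) C q mult_right_mono[OF mult_left_mono[OF w(5), of C], of q] by (simp add: mult_ac)
      moreover have "0 < 3 * C * real w * q" using C w(2) q(2) by simp
      ultimately have le: "\<mu> * real w * ln (C * real v * q) \<le> \<mu> * real w * ln (3 * C * real w * q)"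
        using pos lam by (intro mult_left_mono iffD2[OF ln_le_cancel_iff]) auto
      have "real (n choose w) * exp (\<mu> * real w * ln (C * real v * q))
         \<le> exp (real w * (1 + l - ln (real w))) * exp (\<mu> * real w * ln (3 * C * real w * q))"
        using binomial_le_exp[OF w(1) n] l(2) le by (intro mult_mono) auto
      also have "\<dots> \<le> exp (max 0 (1 - \<mu>) * l)" using X by (simp add: exp_add[symmetric])
      finally show ?thesis unfolding w(3) w_def[symmetric] .
    qed
    show ?thesis
      unfolding split mult.assoc[symmetric]
      using mult_mono[OF main vD] pos by (simp add: mult_ac)
  qed
  have "(\<Sum>v\<in>{2..M}. real (n choose (v - 2)) * exp ((\<mu> * (real v - 2) + 1) * ln (C * real v * q)))
      \<le> real (card {2..M}) * (exp (max 0 (1 - \<mu>) * l) * (C * (D * l) * q))"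
    by (rule sum_bounded_above) (rule summand)
  also have "\<dots> \<le> D * l * (exp (max 0 (1 - \<mu>) * l) * (C * (D * l) * q))"
  proof (rule mult_right_mono)
    have "card {2..M} \<le> M" by simp
    then show "real (card {2..M}) \<le> D * l" using M by linarith
  qed (use C D l q in auto)
  finally show ?thesis by (simp add: small_bound_def)
qed

section \<open>The lower bound on the threshold\<close>

lemma erdos_renyi_support:
  assumes "G \<in> set_pmf (erdos_renyi n p)"
  shows "vertices G = {..<n}" "fin_simple_graph G"
  using assms by (auto simp: erdos_renyi_def fin_simple_graph_def)

text \<open>The threshold size \<open>L\<close> is \<open>ln n\<close> rounded up, but at least two: up to it dense sets are
  counted around the fixed pair \<open>{0, 1}\<close>, and from it up to the size \<open>M\<close> of one merger they are counted everywhere. The constant \<open>D\<close>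
  is such that \<open>M \<le> D * ln n\<close>.\<close>

lemma prob_percolates_le:
  fixes H :: "'a ugraph" and p q :: real
  assumes H: "fin_simple_graph H" "min_degree H \<ge> 2" "num_vertices H \<ge> 3"
  defines "\<mu> \<equiv> lambda_star H"
  defines "D \<equiv> real (num_vertices H) + 2 * real (num_edges H)"
  assumes k: "0 < \<kappa>" "\<kappa> \<le> \<mu>" "\<kappa> \<le> 1 / 2"
  defines "C \<equiv> exp 1 / \<kappa>"
  assumes c: "0 < c" "1 + \<mu> * ln (3 * C * c * D) \<le> -3"
    and l: "1 \<le> l" "l = ln (real n)" and q: "ln q = ln c - l / \<mu> + (1 / \<mu> - 1) * ln l" "0 < q"
    and small: "C * (D * l) * q \<le> 1"
    and p: "0 < p" "p \<le> 1" "p \<le> q"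
  shows "measure_pmf.prob (erdos_renyi n p) {G. percolation_closure H G = complete_graph {..<n}}
     \<le> large_bound \<mu> D l q + small_bound \<mu> C D l q"
proof -
  define L where "L = max 2 (nat \<lceil>l\<rceil>)"
  define M where "M = num_vertices H + num_edges H * L"
  let ?P = "measure_pmf.prob (erdos_renyi n p)"
  have lam: "0 < \<mu>" using lambda_star_pos[OF H] by (simp add: \<mu>_def)
  have D: "3 \<le> D" using H(3) by (simp add: D_def)
  have C: "1 \<le> C"
  proof -
    have "\<kappa> \<le> exp 1" using k(3) exp_ge_add_one_self[of 1] by simp
    then show ?thesis using k(1) by (simp add: C_def)
  qed
  have L: "l \<le> real L" "2 \<le> L" "real L \<le> 2 * l"
    using l(1) unfolding L_def by linarith+
  have LD: "real L \<le> D * l"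
    using L(3) mult_right_mono[of 2 D l] D l(1) by linarith
  have MD: "real M \<le> D * l"
  proof -
    have "real M = real (num_vertices H) * 1 + real (num_edges H) * real L" by (simp add: M_def)
    also have "\<dots> \<le> real (num_vertices H) * l + real (num_edges H) * (2 * l)"
      using l(1) L(3) by (intro add_mono mult_left_mono) auto
    also have "\<dots> = D * l" by (simp add: D_def algebra_simps)
    finally show ?thesis .
  qed
  have n: "2 \<le> n"
  proof (rule ccontr)
    assume "\<not> 2 \<le> n"
    then have "n = 0 \<or> n = 1" by auto
    then show False using l by auto
  qed
  have Mle: "C * real m * q \<le> 1" if "real m \<le> D * l" for m
  proof -
    have "C * real m * q \<le> C * (D * l) * q"
      using that C q by (intro mult_right_mono mult_left_mono) auto
    then show ?thesis using small by simp
  qed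
  let ?e = "{0, 1 :: nat}"
  have e: "?e \<subseteq> {..<n}" "card ?e = 2" "?e \<in> all_pairs {..<n}" using n by (auto simp: all_pairs_def)
  let ?FL = "\<lambda>v. {U. U \<subseteq> {..<n} \<and> card U = v}"
  let ?FS = "\<lambda>v. {U. ?e \<subseteq> U \<and> U \<subseteq> {..<n} \<and> card U = v}"
  let ?XL = "{G :: nat ugraph. \<exists>v\<in>{L..M}. \<exists>U\<in>?FL v. dense_on \<mu> (edges G) U}"
  let ?XS = "{G :: nat ugraph. \<exists>v\<in>{2..L}. \<exists>U\<in>?FS v. dense_on \<mu> (edges G) U}"
  let ?A = "{G. percolation_closure H G = complete_graph {..<n}}"
  have "?A \<inter> set_pmf (erdos_renyi n p) \<subseteq> ?XL \<union> ?XS"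
  proof
    fix G assume G: "G \<in> ?A \<inter> set_pmf (erdos_renyi n p)"
    then have V: "vertices G = {..<n}" "fin_simple_graph G" using erdos_renyi_support by blast+
    have perc: "percolation_closure H G = complete_graph (vertices G)" using G V by simp
    have "(\<exists>U \<subseteq> {..<n}. L \<le> card U \<and> card U \<le> M \<and> dense_on \<mu> (edges G) U) \<or>
         (\<exists>U \<subseteq> {..<n}. ?e \<subseteq> U \<and> card U \<le> max 2 L \<and> dense_on \<mu> (edges G) U)"
      using percolation_dense_on[OF H V(2) _ perc, of ?e L] e(3) unfolding V(1) M_def \<mu>_def by blast
    then show "G \<in> ?XL \<union> ?XS"
    proof (elim disjE exE conjE)
      fix U assume U: "U \<subseteq> {..<n}" "L \<le> card U" "card U \<le> M" "dense_on \<mu> (edges G) U"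
      then show ?thesis by auto
    next
      fix U assume U: "U \<subseteq> {..<n}" "?e \<subseteq> U" "card U \<le> max 2 L" "dense_on \<mu> (edges G) U"
      have "card ?e \<le> card U" using U(1,2) by (intro card_mono) (auto intro: finite_subset)
      then have "card U \<in> {2..L}" using U(3) L(2) e(2) by auto
      then show ?thesis using U by auto
    qed
  qed
  then have "?P (?A \<inter> set_pmf (erdos_renyi n p)) \<le> ?P (?XL \<union> ?XS)"
    by (intro measure_pmf.finite_measure_mono) auto
  then have "?P ?A \<le> ?P (?XL \<union> ?XS)" by (simp only: measure_Int_set_pmf)
  also have "\<dots> \<le> ?P ?XL + ?P ?XS"
    by (rule measure_Un_le) auto
  also have "?P ?XL \<le> (\<Sum>v\<in>{L..M}. real (n choose v) * exp ((\<mu> * (real v - 2) + 1) * ln (C * real v * q)))"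
    unfolding C_def
    by (rule prob_ex_dense_on_le[OF p k]) (use Mle[OF MD] L(2) in \<open>auto simp: C_def n_subsets\<close>)
  also have "\<dots> \<le> large_bound \<mu> D l q"
    by (rule large_sum_le[OF lam C _ c l q small L(1) MD]) (use D in simp)
  also have "?P ?XS \<le> (\<Sum>v\<in>{2..L}. real (n choose (v - 2)) * exp ((\<mu> * (real v - 2) + 1) * ln (C * real v * q)))"
    unfolding C_def
  proof (rule prob_ex_dense_on_le[OF p k])
    show "exp 1 / \<kappa> * real L * q \<le> 1" using Mle[OF LD] by (simp add: C_def)
    show "real (card (?FS v)) \<le> real (n choose (v - 2))" for v
      using card_supersets_of_pair_le[OF e(1,2), of v] by simp
  qed auto
  also have "\<dots> \<le> small_bound \<mu> C D l q"
    by (rule small_sum_le[OF lam C _ c l q LD]) (use D in simp)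
  finally show ?thesis by simp
qed

text \<open>Supplies an element of the set whose infimum is the critical threshold.\<close>

lemma prob_percolates_1:
  "measure_pmf.prob (erdos_renyi n 1) {G. percolation_closure H G = complete_graph {..<n}} = 1"
proof -
  let ?K = "complete_graph {..<n}"
  have fin: "finite (all_pairs {..<n})" by (rule finite_all_pairs) simp
  have b: "bernoulli_pmf 1 = return_pmf True" 
  proof (rule pmf_eqI)
    show "pmf (bernoulli_pmf 1) b = pmf (return_pmf True) b" for b by (cases b) auto
  qed
  have er: "erdos_renyi n 1 = return_pmf ?K"
    unfolding erdos_renyi_def b using fin by (simp add: complete_graph_def cong: conj_cong)
  have K: "fin_simple_graph ?K" by (simp add: complete_graph_def fin_simple_graph_def)
  have "edges ((percolation_step H ^^ t) ?K) \<subseteq> all_pairs {..<n}" for t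
    using percolation_iterate[OF K, where H = H and t = t] by (simp add: fin_simple_graph_def complete_graph_def)
  moreover have "edges ((percolation_step H ^^ 0) ?K) = all_pairs {..<n}" by (simp add: complete_graph_def)
  ultimately have "(\<Union>t. edges ((percolation_step H ^^ t) ?K)) = all_pairs {..<n}" by blast
  then have "percolation_closure H ?K = ?K"
    by (simp add: percolation_closure_def) (simp add: complete_graph_def)
  then show ?thesis unfolding er by (simp add: measure_return)
qed

text \<open>It remains to choose \<open>c\<close> so small that \<open>\<mu> * ln (3 * C * c * D) = - 4\<close>, and to check that both bounds
  tend to zero as \<open>ln n\<close> grows. For \<open>small_bound\<close> this needs \<open>max 0 (1 - \<mu>) < 1 / \<mu>\<close>.\<close>

theorem theorem4:
  fixes H :: "'a ugraph"
  assumes "fin_simple_graph H"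
    and "num_vertices H \<ge> 4"
    and "min_degree H \<ge> 2"
  shows "\<exists>c>0. \<forall>\<^sub>F n in sequentially.
           critical_threshold n H \<ge>
             c * real n powr (- 1 / lambda_star H) * ln (real n) powr (1 / lambda_star H - 1)"
proof -
  have H: "fin_simple_graph H" "min_degree H \<ge> 2" "num_vertices H \<ge> 3" using assms by auto
  define \<mu> where "\<mu> = lambda_star H"
  have lam: "0 < \<mu>" using lambda_star_pos[OF H] by (simp add: \<mu>_def)
  define \<kappa> where "\<kappa> = min \<mu> (1 / 2)"
  have k: "0 < \<kappa>" "\<kappa> \<le> \<mu>" "\<kappa> \<le> 1 / 2" using lam by (auto simp: \<kappa>_def)
  define C where "C = exp 1 / \<kappa>"
  define D where "D = real (num_vertices H) + 2 * real (num_edges H)"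
  have C: "0 < C" using k by (simp add: C_def)
  have D: "0 < D" using assms(2) by (simp add: D_def)
  define c where "c = exp (- 4 / \<mu>) / (3 * C * D)"
  have c0: "0 < c" using C D by (simp add: c_def)
  have "3 * C * c * D = exp (- 4 / \<mu>)" using C D by (simp add: c_def)
  then have c1: "1 + \<mu> * ln (3 * C * c * D) \<le> - 3" using lam by simp
  define Q where "Q l = c * exp (- l / \<mu>) * l powr (1 / \<mu> - 1)" for l
  define \<theta> where "\<theta> = max 0 (1 - \<mu>)"
  have \<theta>: "0 < 1 / \<mu> - \<theta>"
  proof (cases "\<mu> < 1")
    case True
    then have "(1 - \<mu>) * \<mu> < 1" using lam by (smt (verit, best) mult_left_le mult_less_cancel_right2)
    then show ?thesis using True lam by (simp add: \<theta>_def field_simps)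
  next
    case False
    then show ?thesis using lam by (simp add: \<theta>_def)
  qed
  have lnQ: "ln (Q l) = ln c - l / \<mu> + (1 / \<mu> - 1) * ln l" "0 < Q l" if "0 < l" for l
    using that c0 by (auto simp: Q_def ln_mult ln_powr)
  have posl: "eventually (\<lambda>l::real. 0 < l) at_top" by (rule eventually_gt_at_top)
  have lim_large: "((\<lambda>l. large_bound \<mu> D l (Q l)) \<longlongrightarrow> 0) at_top"
  proof -
    have "((\<lambda>l. D * exp (- 2 * \<mu> * ln c) * (l powr (2 * \<mu> - 1) * exp (- 1 * l))) \<longlongrightarrow> D * exp (- 2 * \<mu> * ln c) * 0) at_top"
      by (intro tendsto_mult_left powr_exp_neg_tendsto_0) simp
    moreover have "eventually (\<lambda>l. D * exp (- 2 * \<mu> * ln c) * (l powr (2 * \<mu> - 1) * exp (- 1 * l)) = large_bound \<mu> D l (Q l)) at_top"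
      using posl
    proof eventually_elim
      case (elim l)
      have "2 * \<mu> * ln (Q l) = 2 * \<mu> * ln c - 2 * l + 2 * (1 - \<mu>) * ln l"
        unfolding lnQ(1)[OF elim] using lam by (simp add: field_simps)
      then have "large_bound \<mu> D l (Q l) = D * exp (ln l) * exp (- 3 * l - (2 * \<mu> * ln c - 2 * l + 2 * (1 - \<mu>) * ln l))"
        using elim by (simp add: large_bound_def)
      also have "\<dots> = D * exp (- 2 * \<mu> * ln c) * (exp ((2 * \<mu> - 1) * ln l) * exp (- 1 * l))"
        by (simp add: mult.assoc exp_add[symmetric] algebra_simps)
      finally show ?case using elim by (simp add: powr_def)
    qed
    ultimately show ?thesis unfolding mult_zero_right by (rule Lim_transform_eventually)
  qed
  have lim_small: "((\<lambda>l. small_bound \<mu> C D l (Q l)) \<longlongrightarrow> 0) at_top"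
  proof -
    have "((\<lambda>l. D * C * D * c * (l powr (1 / \<mu> + 1) * exp (- (1 / \<mu> - \<theta>) * l))) \<longlongrightarrow> D * C * D * c * 0) at_top"
      by (intro tendsto_mult_left powr_exp_neg_tendsto_0 \<theta>)
    moreover have "eventually (\<lambda>l. D * C * D * c * (l powr (1 / \<mu> + 1) * exp (- (1 / \<mu> - \<theta>) * l)) = small_bound \<mu> C D l (Q l)) at_top"
      using posl
    proof eventually_elim
      case (elim l)
      have "l powr (1 / \<mu> + 1) = l powr (2 + (1 / \<mu> - 1))" by (simp add: add.commute)
      also have "\<dots> = l ^ 2 * l powr (1 / \<mu> - 1)" unfolding powr_add using elim by (simp add: powr_realpow)
      finally have 1: "l powr (1 / \<mu> + 1) = l ^ 2 * l powr (1 / \<mu> - 1)" .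
      have 2: "exp (- (1 / \<mu> - \<theta>) * l) = exp (\<theta> * l) * exp (- l / \<mu>)"
        by (simp add: exp_add[symmetric] algebra_simps)
      show ?case unfolding 1 2 small_bound_def Q_def \<theta>_def[symmetric]
        by (simp add: power2_eq_square mult_ac)
    qed
    ultimately show ?thesis unfolding mult_zero_right by (rule Lim_transform_eventually)
  qed
  have lim_Q: "((\<lambda>l. C * (D * l) * Q l) \<longlongrightarrow> 0) at_top"
  proof -
    have "((\<lambda>l. C * D * c * (l powr (1 / \<mu>) * exp (- (1 / \<mu>) * l))) \<longlongrightarrow> C * D * c * 0) at_top"
      by (intro tendsto_mult_left powr_exp_neg_tendsto_0) (use lam in simp)
    moreover have "eventually (\<lambda>l. C * D * c * (l powr (1 / \<mu>) * exp (- (1 / \<mu>) * l)) = C * (D * l) * Q l) at_top"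
      using posl
    proof eventually_elim
      case (elim l)
      have "l powr (1 / \<mu>) = l powr (1 + (1 / \<mu> - 1))" by simp
      also have "\<dots> = l * l powr (1 / \<mu> - 1)" unfolding powr_add using elim by simp
      finally show ?case by (simp add: Q_def mult_ac)
    qed
    ultimately show ?thesis unfolding mult_zero_right by (rule Lim_transform_eventually)
  qed
  have lnlim: "filterlim (\<lambda>n. ln (real n)) at_top sequentially"
    by (rule filterlim_compose[OF ln_at_top filterlim_real_sequentially])
  have "eventually (\<lambda>l. 1 \<le> l \<and> C * (D * l) * Q l \<le> 1 \<and>
      large_bound \<mu> D l (Q l) < 1 / 4 \<and> small_bound \<mu> C D l (Q l) < 1 / 4) at_top"
  proof (intro eventually_conj)
    show "eventually (\<lambda>l::real. 1 \<le> l) at_top" by (rule eventually_ge_at_top)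
    show "eventually (\<lambda>l. C * (D * l) * Q l \<le> 1) at_top"
      using order_tendstoD(2)[OF lim_Q, of 1] by (auto elim: eventually_mono)
  qed (use order_tendstoD(2)[OF lim_large, of "1/4"] order_tendstoD(2)[OF lim_small, of "1/4"] in auto)
  from eventually_compose_filterlim[OF this lnlim]
  have "\<forall>\<^sub>F n in sequentially. critical_threshold n H \<ge> Q (ln (real n))"
  proof eventually_elim
    case (elim n)
    define l where "l = ln (real n)"
    have l: "1 \<le> l" "C * (D * l) * Q l \<le> 1"
      "large_bound \<mu> D l (Q l) < 1 / 4" "small_bound \<mu> C D l (Q l) < 1 / 4"
      using elim by (auto simp: l_def)
    then have l0: "0 < l" by simp
    show ?case
      unfolding critical_threshold_def l_def[symmetric]
    proof (rule cInf_greatest)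
      show "{p. 0 < p \<and> p \<le> 1 \<and> measure_pmf.prob (erdos_renyi n p)
         {G. percolation_closure H G = complete_graph {..<n}} \<ge> 1 / 2} \<noteq> {}"
        using prob_percolates_1[of n H] by (intro ex_in_conv[THEN iffD1] exI[of _ 1]) simp
      fix p assume p: "p \<in> {p. 0 < p \<and> p \<le> 1 \<and> measure_pmf.prob (erdos_renyi n p)
         {G. percolation_closure H G = complete_graph {..<n}} \<ge> 1 / 2}"
      show "Q l \<le> p"
      proof (rule ccontr)
        assume "\<not> Q l \<le> p"
        then have pQ: "p \<le> Q l" by simp
        have "measure_pmf.prob (erdos_renyi n p) {G. percolation_closure H G = complete_graph {..<n}}
            \<le> large_bound \<mu> D l (Q l) + small_bound \<mu> C D l (Q l)"
          unfolding \<mu>_def D_def C_def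
          by (rule prob_percolates_le[OF H _ _ _ c0])
             (use k c1 l l0 lnQ[OF l0] p pQ in \<open>auto simp: \<mu>_def D_def C_def l_def\<close>)
        then show False using p l by auto
      qed
    qed
  qed
  moreover have "\<forall>\<^sub>F n in sequentially. Q (ln (real n)) =
      c * real n powr (- 1 / \<mu>) * ln (real n) powr (1 / \<mu> - 1)"
    using eventually_gt_at_top[of 0] by eventually_elim (simp add: Q_def powr_def)
  ultimately have "\<forall>\<^sub>F n in sequentially. critical_threshold n H \<ge>
      c * real n powr (- 1 / \<mu>) * ln (real n) powr (1 / \<mu> - 1)"
    by eventually_elim simp
  then show ?thesis using c0 unfolding \<mu>_def by blast
qed

end
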